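(* Let $X$ be a normed space, let $I:X\to\mathbb{R}$ be a Fréchet differentiable functional and let $A\subset X$ be a nonempty subset of critical points of $I$. Suppose that given $u,v\in A$ with $u\ne v$, there exists $\gamma\in C([0,1],X)$ such that (a) $\gamma(0)=u$, $\gamma(1)=v$; (b) $\gamma$ is locally Lipschitz at $t=0$, that is, there are $\delta>0$ and $C$ such that $\|\gamma(t)-u\|\le Ct$ for each $t\in[0,\delta]$; (c) $I(\gamma(t))\le(1-t)I(u)+tI(v)$ for all $t\in(0,1)$. Then (i) $I$ is constant on $A$; (ii) if $A$ contains a local minimum $u_0$ of $I$ and the strict inequality holds in condition (c), then $A=\{u_0\}$.
   Context: A critical point of $I$ is a point $u\in X$ with $I'(u)=0$. *)

theory Defs
  imports "HOL-Analysis.Analysis"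
begin

definition critical_point :: "('a::real_normed_vector \<Rightarrow> real) \<Rightarrow> 'a \<Rightarrow> bool" where
  "critical_point I u \<longleftrightarrow> (I has_derivative (\<lambda>h. 0)) (at u)"

definition local_minimum :: "('a::real_normed_vector \<Rightarrow> real) \<Rightarrow> 'a \<Rightarrow> bool" where
  "local_minimum I u \<longleftrightarrow> (\<exists>\<epsilon>>0. \<forall>x. norm (x - u) < \<epsilon> \<longrightarrow> I u \<le> I x)"

text \<open>
  A curve in \<open>C([0,1], X)\<close> is a total function that is continuous on \<open>{0..1}\<close>; its values
  elsewhere are irrelevant. Hence the bound \<open>\<delta> \<le> 1\<close>, which keeps \<open>[0, \<delta>]\<close> inside the domain.
\<close>

definition locally_Lipschitz_at_0 :: "(real \<Rightarrow> 'a::real_normed_vector) \<Rightarrow> bool" where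
  "locally_Lipschitz_at_0 \<gamma> \<longleftrightarrow>
     (\<exists>\<delta> C. 0 < \<delta> \<and> \<delta> \<le> 1 \<and> (\<forall>t\<in>{0..\<delta>}. norm (\<gamma> t - \<gamma> 0) \<le> C * t))"

definition Lipschitz_curve_from_to ::
    "(real \<Rightarrow> 'a::real_normed_vector) \<Rightarrow> 'a \<Rightarrow> 'a \<Rightarrow> bool" where
  "Lipschitz_curve_from_to \<gamma> u v \<longleftrightarrow>
     continuous_on {0..1} \<gamma> \<and> \<gamma> 0 = u \<and> \<gamma> 1 = v \<and> locally_Lipschitz_at_0 \<gamma>"

end

(* If I v < I u, condition (c) makes I decrease along the curve at a linear rate in t, while
   I'(u) = 0 and the Lipschitz bound at t = 0 only allow a decrease of order o(t). Hence
   I u <= I v, and exchanging u and v gives equality. Under strict inequality, I is then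
   strictly smaller than I u0 along any curve leaving u0, so u0 is no local minimum unless
   A has no other point. *)
theory Submission
  imports Defs
begin

text \<open>Extracts from the Lipschitz bound the form used below: interior parameters
  \<open>t\<close> whose points are arbitrarily close to \<open>u\<close>, at distance at most
  \<open>C * t\<close>. The constant \<open>C\<close> is fixed before \<open>d\<close>, because
  \<open>d\<close> will later be chosen depending on \<open>C\<close>.\<close>

lemma Lipschitz_curve_near_start:
  assumes "Lipschitz_curve_from_to \<gamma> u v"
  obtains C where "C > 0"
    and "\<And>d. d > 0 \<Longrightarrow> \<exists>t\<in>{0<..<1}. norm (\<gamma> t - u) < d \<and> norm (\<gamma> t - u) \<le> C * t"
proof -
  from assms obtain \<delta> K where \<delta>: "0 < \<delta>" "\<delta> \<le> 1"
    and K: "\<And>t. t \<in> {0..\<delta>} \<Longrightarrow> norm (\<gamma> t - u) \<le> K * t"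
    unfolding Lipschitz_curve_from_to_def locally_Lipschitz_at_0_def by blast
  \<comment> \<open>\<open>K\<close> comes with no sign condition and may be 0; enlarging it makes
    division by \<open>C\<close> safe.\<close>
  define C where "C = \<bar>K\<bar> + 1"
  have "C > 0" by (simp add: C_def)
  moreover have "\<exists>t\<in>{0<..<1}. norm (\<gamma> t - u) < d \<and> norm (\<gamma> t - u) \<le> C * t" if "d > 0" for d
  proof -
    \<comment> \<open>The first bound keeps \<open>t\<close> in the Lipschitz interval and, since
      \<open>\<delta> \<le> 1\<close>, below 1; the second gives \<open>C * t \<le> d / 2\<close>,
      which makes the distance strictly less than \<open>d\<close>.\<close>
    define t where "t = min (\<delta> / 2) (d / (2 * C))"
    have t: "0 < t" "t \<le> \<delta> / 2" "t \<le> d / (2 * C)"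
      using \<delta> \<open>d > 0\<close> \<open>C > 0\<close> by (auto simp: t_def)
    have "C * t \<le> d / 2"
      using t(3) \<open>C > 0\<close> by (simp add: field_simps)
    moreover have "K * t \<le> C * t"
      using t(1) by (intro mult_right_mono) (auto simp: C_def)
    moreover have "norm (\<gamma> t - u) \<le> K * t"
      using K t \<delta> by simp
    ultimately have "norm (\<gamma> t - u) < d \<and> norm (\<gamma> t - u) \<le> C * t"
      using \<open>d > 0\<close> by linarith
    moreover have "t \<in> {0<..<1}"
      using t \<delta> by simp
    ultimately show ?thesis by blast
  qed
  ultimately show ?thesis using that by blast
qed

text \<open>The conclusion is one-sided because the Lipschitz bound holds at the start of the curve
  only; the reverse inequality takes a curve from \<open>v\<close> to \<open>u\<close>.\<close>

lemma critical_point_le_endpoint: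
  assumes "critical_point I u" and \<gamma>: "Lipschitz_curve_from_to \<gamma> u v"
    and conv: "\<And>t. t \<in> {0<..<1} \<Longrightarrow> I (\<gamma> t) \<le> (1 - t) * I u + t * I v"
  shows "I u \<le> I v"
proof (rule ccontr)
  assume "\<not> I u \<le> I v"
  obtain C where C: "C > 0"
    and near: "\<And>d. d > 0 \<Longrightarrow> \<exists>t\<in>{0<..<1}. norm (\<gamma> t - u) < d \<and> norm (\<gamma> t - u) \<le> C * t"
    using Lipschitz_curve_near_start[OF \<gamma>] by blast
  \<comment> \<open>With this \<open>e\<close>, the drop \<open>e * (C * t)\<close> that the
    vanishing derivative permits is exactly half of the drop \<open>t * (I u - I v)\<close> that
    convexity forces.\<close>
  define e where "e = (I u - I v) / (2 * C)"
  have "e > 0" using C \<open>\<not> I u \<le> I v\<close> by (simp add: e_def)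
  with \<open>critical_point I u\<close> obtain d where "d > 0"
    and d: "\<And>y. norm (y - u) < d \<Longrightarrow> \<bar>I y - I u\<bar> \<le> e * norm (y - u)"
    unfolding critical_point_def has_derivative_at_alt by auto
  from near[OF \<open>d > 0\<close>] obtain t where t: "t \<in> {0<..<1}"
    and lt: "norm (\<gamma> t - u) < d" and le: "norm (\<gamma> t - u) \<le> C * t" by blast
  have "t * (I u - I v) \<le> I u - I (\<gamma> t)"
    using conv[OF t] by (simp add: algebra_simps)
  also have "\<dots> \<le> e * norm (\<gamma> t - u)"
    using d[OF lt] by simp
  also have "\<dots> \<le> e * (C * t)"
    using le \<open>e > 0\<close> by simp
  also have "\<dots> = t * (I u - I v) / 2"
    using C by (simp add: e_def)
  finally show False
    using t \<open>\<not> I u \<le> I v\<close> by (auto simp: mult_le_0_iff)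
qed

text \<open>The curve has interior points in the ball on which \<open>u\<close> is minimal. One such
  point is enough to contradict the strict inequality.\<close>

lemma local_minimum_le_on_curve:
  assumes "local_minimum I u" and \<gamma>: "Lipschitz_curve_from_to \<gamma> u v"
  obtains t where "t \<in> {0<..<1}" and "I u \<le> I (\<gamma> t)"
proof -
  obtain \<epsilon> where "\<epsilon> > 0" and \<epsilon>: "\<And>x. norm (x - u) < \<epsilon> \<Longrightarrow> I u \<le> I x"
    using \<open>local_minimum I u\<close> unfolding local_minimum_def by blast
  with Lipschitz_curve_near_start[OF \<gamma>] that show thesis by metis
qed

theorem theorem2p1:
  fixes I :: "'a::real_normed_vector \<Rightarrow> real" and A :: "'a set"
  assumes "\<forall>x. I differentiable (at x)"
    and "A \<noteq> {}"
    and "\<forall>u\<in>A. critical_point I u"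
    and "\<forall>u\<in>A. \<forall>v\<in>A. u \<noteq> v \<longrightarrow>
           (\<exists>\<gamma>. Lipschitz_curve_from_to \<gamma> u v \<and>
                (\<forall>t\<in>{0<..<1}. I (\<gamma> t) \<le> (1 - t) * I u + t * I v))"
  shows "I constant_on A \<and>
         (\<forall>u\<^sub>0\<in>A. local_minimum I u\<^sub>0 \<and>
           (\<forall>u\<in>A. \<forall>v\<in>A. u \<noteq> v \<longrightarrow>
             (\<exists>\<gamma>. Lipschitz_curve_from_to \<gamma> u v \<and>
                  (\<forall>t\<in>{0<..<1}. I (\<gamma> t) < (1 - t) * I u + t * I v)))
           \<longrightarrow> A = {u\<^sub>0})"
proof (intro conjI ballI impI)
  have le: "I u \<le> I v" if "u \<in> A" "v \<in> A" for u v
  proof (cases "u = v")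
    case False
    with that assms(4) obtain \<gamma> where "Lipschitz_curve_from_to \<gamma> u v"
      and "\<forall>t\<in>{0<..<1}. I (\<gamma> t) \<le> (1 - t) * I u + t * I v"
      by blast
    with that assms(3) show ?thesis
      using critical_point_le_endpoint by blast
  qed simp
  \<comment> \<open>The fact \<open>le\<close> covers all ordered pairs, so it applies with
    \<open>u\<close> and \<open>v\<close> exchanged.\<close>
  then have const: "I u = I v" if "u \<in> A" "v \<in> A" for u v
    using that by (simp add: order_antisym)
  then show "I constant_on A"
    unfolding constant_on_def by blast
  fix u\<^sub>0
  assume "u\<^sub>0 \<in> A" and min_strict: "local_minimum I u\<^sub>0 \<and>
    (\<forall>u\<in>A. \<forall>v\<in>A. u \<noteq> v \<longrightarrow>
      (\<exists>\<gamma>. Lipschitz_curve_from_to \<gamma> u v \<and>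
           (\<forall>t\<in>{0<..<1}. I (\<gamma> t) < (1 - t) * I u + t * I v)))"
  have "v = u\<^sub>0" if "v \<in> A" for v
  proof (rule ccontr)
    assume "v \<noteq> u\<^sub>0"
    with min_strict \<open>u\<^sub>0 \<in> A\<close> \<open>v \<in> A\<close> obtain \<gamma> where \<gamma>: "Lipschitz_curve_from_to \<gamma> u\<^sub>0 v"
      and strict: "\<And>t. t \<in> {0<..<1} \<Longrightarrow> I (\<gamma> t) < (1 - t) * I u\<^sub>0 + t * I v"
      by metis
    obtain t where t: "t \<in> {0<..<1}" and "I u\<^sub>0 \<le> I (\<gamma> t)"
      using local_minimum_le_on_curve[OF _ \<gamma>] min_strict by blast
    \<comment> \<open>Since \<open>I\<close> agrees at the two endpoints, the convex combination
      collapses to \<open>I u\<^sub>0\<close>.\<close>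
    moreover have "I (\<gamma> t) < I u\<^sub>0"
      using strict[OF t] const[OF \<open>u\<^sub>0 \<in> A\<close> \<open>v \<in> A\<close>] by (simp add: algebra_simps)
    ultimately show False by simp
  qed
  with \<open>u\<^sub>0 \<in> A\<close> show "A = {u\<^sub>0}" by blast
qed

end
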